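(* Let $n\ge 1$ be an integer. If the $4n$ vertices of the graph $K_4\times P_n$ are colored uniformly and independently with two colors, the expected number of blocks is $$\mathbb{E}[X_2(K_{4}\times P_n)]=\frac{2^{4 n-7}(175 + 65 n)}{2^{4n}}.$$
   Context: $K_m$ is the complete graph on $m$ vertices and $P_n$ the path graph on $n$ vertices. The product $G_1\times G_2$ of graphs $G_1=(V_1,E_1)$, $G_2=(V_2,E_2)$ is the Cartesian product: its vertex set is $V_1\times V_2$, and $(v_1,v_2),(w_1,w_2)$ are adjacent iff ($v_1=w_1$ and $\{v_2,w_2\}\in E_2$) or ($v_2=w_2$ and $\{v_1,w_1\}\in E_1$). Given a coloring of the vertices of a finite graph $G$ with $k$ colors, the blocks are the connected components of the subgraph of $G$ formed by all vertices and all edges whose two endpoints have the same color. $X_k(G)$ denotes the number of blocks when each vertex of $G$ receives independently a uniformly random color among $k$ colors. *)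

theory Defs
  imports "HOL-Probability.Product_PMF"
begin

text \<open>A simple graph is a pair of a vertex set and a set of two-element vertex sets.\<close>

type_synonym 'a graph = "'a set \<times> 'a set set"

abbreviation verts :: "'a graph \<Rightarrow> 'a set" where
  "verts \<equiv> fst"

abbreviation edges :: "'a graph \<Rightarrow> 'a set set" where
  "edges \<equiv> snd"

definition complete_graph :: "nat \<Rightarrow> nat graph" where
  "complete_graph m = ({..<m}, {{u, v} | u v. u < m \<and> v < m \<and> u \<noteq> v})"

definition path_graph :: "nat \<Rightarrow> nat graph" where
  "path_graph n = ({..<n}, {{i, Suc i} | i. Suc i < n})"

definition cartesian_product :: "'a graph \<Rightarrow> 'b graph \<Rightarrow> ('a \<times> 'b) graph" where
  "cartesian_product G H =
     (verts G \<times> verts H,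
      {{(v1, v2), (w1, w2)} | v1 v2 w1 w2.
         (v1, v2) \<in> verts G \<times> verts H \<and> (w1, w2) \<in> verts G \<times> verts H \<and>
         (v1 = w1 \<and> {v2, w2} \<in> edges H \<or> v2 = w2 \<and> {v1, w1} \<in> edges G)})"

definition reachable :: "'a graph \<Rightarrow> ('a \<times> 'a) set" where
  "reachable G = {(u, v) \<in> verts G \<times> verts G. (u, v) \<in> {(x, y). {x, y} \<in> edges G}\<^sup>*}"

text \<open>Connected components are represented by their vertex sets.\<close>

definition connected_components :: "'a graph \<Rightarrow> 'a set set" where
  "connected_components G = verts G // reachable G"

definition monochromatic_subgraph :: "'a graph \<Rightarrow> ('a \<Rightarrow> nat) \<Rightarrow> 'a graph" where
  "monochromatic_subgraph G c = (verts G, {e \<in> edges G. \<forall>u\<in>e. \<forall>v\<in>e. c u = c v})"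

definition blocks :: "'a graph \<Rightarrow> ('a \<Rightarrow> nat) \<Rightarrow> 'a set set" where
  "blocks G c = connected_components (monochromatic_subgraph G c)"

text \<open>The value outside the vertex set is fixed to \<open>0\<close>; it does not influence the blocks.\<close>

definition random_coloring :: "nat \<Rightarrow> 'a graph \<Rightarrow> ('a \<Rightarrow> nat) pmf" where
  "random_coloring k G = Pi_pmf (verts G) 0 (\<lambda>_. pmf_of_set {..<k})"

definition expected_blocks :: "nat \<Rightarrow> 'a graph \<Rightarrow> real" where
  "expected_blocks k G =
     measure_pmf.expectation (random_coloring k G) (\<lambda>c. real (card (blocks G c)))"

end

theory Submission
  imports Defs
begin

text \<open>
  In a coloring of \<open>K\<^sub>m \<times> P\<^sub>n\<close>, the vertices of one color in one copy of \<open>K\<^sub>m\<close> (a layer) are connected,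
  so a block is determined by its color and by its first layer. Hence the number of blocks is the
  number of pairs of a layer \<open>j\<close> and a color \<open>a\<close> such that \<open>a\<close> occurs in layer \<open>j\<close>, but at no
  position at which it also occurs in layer \<open>j - 1\<close>. The different positions are independent: no
  position has color \<open>a\<close> in both layers with probability \<open>(1 - 1/k\<^sup>2)\<^sup>m\<close>, and \<open>a\<close> does not occur in
  layer \<open>j\<close> with probability \<open>(1 - 1/k)\<^sup>m\<close>. Linearity of expectation finishes the proof.
\<close>

text \<open>The class of \<open>x\<close> is the fibre of \<open>f\<close> through \<open>x\<close>,
  so classes correspond to values of \<open>f\<close>. Blocks can thus be counted through a complete
  invariant.\<close>

lemma card_quotient_eq_card_image:
  assumes "R \<subseteq> A \<times> A" and "\<And>x y. x \<in> A \<Longrightarrow> y \<in> A \<Longrightarrow> (x, y) \<in> R \<longleftrightarrow> f x = f y"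
  shows "card (A // R) = card (f ` A)"
proof -
  have "R `` {x} = {y \<in> A. f y = f x}" if "x \<in> A" for x
    using assms that by (auto simp: Image_def)
  then have "A // R = (\<lambda>z. {y \<in> A. f y = z}) ` f ` A"
    unfolding quotient_def by auto
  moreover have "inj_on (\<lambda>z. {y \<in> A. f y = z}) (f ` A)"
    by (rule inj_onI) blast
  ultimately show ?thesis
    by (simp add: card_image)
qed

text \<open>Events on disjoint sets of coordinates are independent, and each factor is the
  complement of a product event. Singleton cells will express that a color misses a layer, vertical
  pairs that it never repeats at a position.\<close>

lemma prob_Pi_pmf_no_constant_cell:
  assumes "finite I" "finite L" and K: "\<And>l. l \<in> L \<Longrightarrow> K l \<subseteq> I" and disj: "disjoint_family_on K L"
  shows "measure_pmf.prob (Pi_pmf I d p) {f. \<forall>l\<in>L. \<exists>x\<in>K l. f x \<noteq> a} =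
           (\<Prod>l\<in>L. 1 - (\<Prod>x\<in>K l. pmf (p x) a))"
proof (cases "L = {}")
  case False
  define M where "M = Pi_pmf I d p"
  \<comment> \<open>The removed set contains only the function on \<open>K l\<close> that is
    constantly \<open>a\<close>.\<close>
  define B where "B = (\<lambda>l. space (PiM (K l) (\<lambda>_. count_space UNIV)) - PiE (K l) (\<lambda>_. {a}))"
  have fin: "finite (K l)" if "l \<in> L" for l
    using K[OF that] \<open>finite I\<close> finite_subset by blast
  have indep: "prob_space.indep_vars M (\<lambda>l. PiM (K l) (\<lambda>_. count_space UNIV))
      (\<lambda>l f. restrict (\<lambda>x. f x) (K l)) L"
    unfolding M_def using indep_vars_Pi_pmf[OF \<open>finite I\<close>] K disj
    by (rule prob_space.indep_vars_restrict[OF measure_pmf.prob_space_axioms])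
  have B_sets: "B l \<in> sets (PiM (K l) (\<lambda>_. count_space UNIV))" if "l \<in> L" for l
    unfolding B_def using fin[OF that] by (intro sets.Diff sets.top sets_PiM_I_finite) auto
  have B_iff: "restrict f (K l) \<in> B l \<longleftrightarrow> (\<exists>x\<in>K l. f x \<noteq> a)" for f l
    by (auto simp: B_def space_PiM fun_eq_iff restrict_def split: if_splits)
  have cell: "measure_pmf.prob M {f. \<exists>x\<in>K l. f x \<noteq> a} = 1 - (\<Prod>x\<in>K l. pmf (p x) a)"
    if "l \<in> L" for l
  proof -
    \<comment> \<open>Padding with \<open>UNIV\<close> outside the cell gives a product event over
      all of \<open>I\<close>; the added factors are 1.\<close>
    let ?S = "\<lambda>x. if x \<in> K l then {a} else UNIV"
    have "{f. \<exists>x\<in>K l. f x \<noteq> a} = UNIV - Pi I ?S"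
      using K[OF that] by (auto simp: Pi_iff split: if_splits)
    moreover have "measure_pmf.prob M (Pi I ?S) = (\<Prod>x\<in>I. measure_pmf.prob (p x) (?S x))"
      unfolding M_def using \<open>finite I\<close> by (rule measure_Pi_pmf_Pi)
    moreover have "\<dots> = (\<Prod>x\<in>K l. pmf (p x) a)"
      using K[OF that] \<open>finite I\<close>
      by (intro prod.mono_neutral_cong_right) (auto simp: pmf.rep_eq)
    ultimately show ?thesis
      using measure_pmf.prob_compl[of "Pi I ?S" M] by simp
  qed
  have "measure_pmf.prob M {f. \<forall>l\<in>L. \<exists>x\<in>K l. f x \<noteq> a} =
      measure_pmf.prob M (\<Inter>l\<in>L. (\<lambda>f. restrict (\<lambda>x. f x) (K l)) -` B l \<inter> space M)"
    using False by (intro arg_cong[where f = "measure_pmf.prob M"]) (auto simp: B_iff)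
  also have "\<dots> = (\<Prod>l\<in>L. measure_pmf.prob M ((\<lambda>f. restrict (\<lambda>x. f x) (K l)) -` B l \<inter> space M))"
    using indep False \<open>finite L\<close> B_sets by (rule prob_space.indep_varsD_finite[OF measure_pmf.prob_space_axioms])
  also have "\<dots> = (\<Prod>l\<in>L. measure_pmf.prob M {f. \<exists>x\<in>K l. f x \<noteq> a})"
    by (simp add: vimage_def B_iff)
  finally show ?thesis
    by (simp add: cell flip: M_def)
qed simp

section \<open>Adjacency in the product graph\<close>

lemma edges_cartesian_product:
  "{(v1, v2), (w1, w2)} \<in> edges (cartesian_product G H) \<longleftrightarrow>
     (v1, v2) \<in> verts G \<times> verts H \<and> (w1, w2) \<in> verts G \<times> verts H \<and>
     (v1 = w1 \<and> {v2, w2} \<in> edges H \<or> v2 = w2 \<and> {v1, w1} \<in> edges G)"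
  unfolding cartesian_product_def snd_conv mem_Collect_eq
  by (rule iffI, fastforce simp: doubleton_eq_iff insert_commute, blast)

lemma edges_path_graph: "{i, j} \<in> edges (path_graph n) \<longleftrightarrow> i < n \<and> j < n \<and> (j = Suc i \<or> i = Suc j)"
  by (auto simp: path_graph_def doubleton_eq_iff)

lemma edges_complete_graph: "{u, v} \<in> edges (complete_graph m) \<longleftrightarrow> u < m \<and> v < m \<and> u \<noteq> v"
  by (auto simp: complete_graph_def doubleton_eq_iff)

lemma edges_complete_path_product:
  "{(v, i), (w, j)} \<in> edges (cartesian_product (complete_graph m) (path_graph n)) \<longleftrightarrow>
     v < m \<and> w < m \<and> i < n \<and> j < n \<and> (v = w \<and> (j = Suc i \<or> i = Suc j) \<or> i = j \<and> v \<noteq> w)"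
  unfolding edges_cartesian_product edges_path_graph edges_complete_graph
  by (auto simp: complete_graph_def path_graph_def)

definition linked :: "nat \<Rightarrow> (nat \<times> nat \<Rightarrow> nat) \<Rightarrow> nat \<Rightarrow> nat \<Rightarrow> bool" where
  "linked m c a i \<longleftrightarrow> (\<exists>v<m. c (v, i) = a \<and> c (v, Suc i) = a)"

text \<open>If \<open>a\<close> occurs in layer \<open>i\<close>, this is the lowest layer of the
  block containing those vertices: the descent continues as long as consecutive layers are
  linked.\<close>

fun first_layer :: "nat \<Rightarrow> (nat \<times> nat \<Rightarrow> nat) \<Rightarrow> nat \<Rightarrow> nat \<Rightarrow> nat" where
  "first_layer m c a 0 = 0"
| "first_layer m c a (Suc i) = (if linked m c a i then first_layer m c a i else Suc i)"

fun block_start :: "nat \<Rightarrow> (nat \<times> nat \<Rightarrow> nat) \<Rightarrow> nat \<Rightarrow> nat \<Rightarrow> bool" where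
  "block_start m c a 0 \<longleftrightarrow> (\<exists>v<m. c (v, 0) = a)"
| "block_start m c a (Suc i) \<longleftrightarrow> (\<exists>v<m. c (v, Suc i) = a) \<and> \<not> linked m c a i"

lemma first_layer_le: "first_layer m c a i \<le> i"
  by (induction i) auto

text \<open>Each link supplies a vertex of color \<open>a\<close> one layer below, so the color is
  still present where the descent stops. That vertex may sit at another position, hence the
  induction for arbitrary \<open>v\<close>.\<close>

lemma block_start_first_layer:
  "v < m \<Longrightarrow> c (v, i) = a \<Longrightarrow> block_start m c a (first_layer m c a i)"
  by (induction i arbitrary: v) (auto simp: linked_def)

lemma first_layer_block_start: "block_start m c a i \<Longrightarrow> first_layer m c a i = i"
  by (cases i) auto

lemma block_start_color: "block_start m c a i \<Longrightarrow> \<exists>v<m. c (v, i) = a"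
  by (cases i) auto

lemma card_blocks_complete_path_product:
  assumes "\<And>x. c x < k"
  shows "card (blocks (cartesian_product (complete_graph m) (path_graph n)) c) =
           (\<Sum>a<k. \<Sum>i<n. of_bool (block_start m c a i))"
proof -
  let ?G = "cartesian_product (complete_graph m) (path_graph n)"
  let ?H = "monochromatic_subgraph ?G c"
  let ?V = "{..<m} \<times> {..<n}"
  define r where "r = {(x, y). {x, y} \<in> edges ?H}"
  define f where "f = (\<lambda>(v, i). (c (v, i), first_layer m c (c (v, i)) i))"
  have verts: "verts ?H = ?V"
    by (simp add: monochromatic_subgraph_def cartesian_product_def complete_graph_def path_graph_def)
  have r_iff: "((v, i), (w, j)) \<in> r \<longleftrightarrow> v < m \<and> w < m \<and> i < n \<and> j < n \<and> c (v, i) = c (w, j) \<and>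
      (v = w \<and> (j = Suc i \<or> i = Suc j) \<or> i = j \<and> v \<noteq> w)" for v i w j
    unfolding r_def monochromatic_subgraph_def by (auto simp: edges_complete_path_product)
  have "sym r"
    by (auto simp: r_def sym_def insert_commute)
  then have sym_rtrancl: "sym (r\<^sup>*)"
    by (rule sym_rtrancl)
  \<comment> \<open>An edge inside a layer changes neither component; a vertical monochromatic edge
    is itself a link, across which \<open>first_layer\<close> is constant.\<close>
  have f_step: "f x = f y" if "(x, y) \<in> r" for x y
    using that by (cases x; cases y) (auto simp: r_iff f_def linked_def)
  have f_rtrancl: "f x = f y" if "(x, y) \<in> r\<^sup>*" for x y
    using that by induction (auto dest: f_step)
  \<comment> \<open>Move within the layer to a linked position \<open>u\<close>, step down, and
    recurse. The endpoint \<open>w\<close> is arbitrary so that two vertices with equal invariant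
    can be joined to the same one.\<close>
  have to_first: "((v, i), (w, first_layer m c a i)) \<in> r\<^sup>*"
    if "v < m" "i < n" "c (v, i) = a" "w < m" "c (w, first_layer m c a i) = a" for v w i a
    using that
  proof (induction i arbitrary: v)
    case 0
    then show ?case
      by (cases "v = w") (auto intro!: r_into_rtrancl simp: r_iff)
  next
    case (Suc i)
    show ?case
    proof (cases "linked m c a i")
      case True
      then obtain u where u: "u < m" "c (u, i) = a" "c (u, Suc i) = a"
        by (auto simp: linked_def)
      have "((v, Suc i), (u, Suc i)) \<in> r\<^sup>*"
        using Suc.prems u by (cases "v = u") (auto intro!: r_into_rtrancl simp: r_iff)
      also have "((u, Suc i), (u, i)) \<in> r"
        using Suc.prems u by (auto simp: r_iff)
      also have "((u, i), (w, first_layer m c a i)) \<in> r\<^sup>*"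
        using Suc u True by auto
      finally show ?thesis
        using True by simp
    next
      case False
      then show ?thesis
        using Suc.prems by (cases "v = w") (auto intro!: r_into_rtrancl simp: r_iff)
    qed
  qed
  have reach: "(x, y) \<in> reachable ?H \<longleftrightarrow> f x = f y" if "x \<in> ?V" "y \<in> ?V" for x y
  proof
    assume "(x, y) \<in> reachable ?H"
    then show "f x = f y"
      by (intro f_rtrancl) (auto simp: reachable_def r_def)
  next
    assume eq: "f x = f y"
    obtain v i w j where [simp]: "x = (v, i)" "y = (w, j)"
      by (cases x; cases y)
    have vw: "v < m" "i < n" "w < m" "j < n" and col: "c (w, j) = c (v, i)"
      and first: "first_layer m c (c (v, i)) j = first_layer m c (c (v, i)) i"
      using that eq by (auto simp: f_def)
    obtain u where u: "u < m" "c (u, first_layer m c (c (v, i)) i) = c (v, i)"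
      using block_start_color[OF block_start_first_layer[where i = i and v = v]] vw by blast
    have "(x, (u, first_layer m c (c (v, i)) i)) \<in> r\<^sup>*"
      using vw u by (auto intro: to_first)
    moreover have "(y, (u, first_layer m c (c (v, i)) i)) \<in> r\<^sup>*"
      using to_first[of w j "c (v, i)" u] vw col first u by simp
    ultimately have "(x, y) \<in> r\<^sup>*"
      using sym_rtrancl by (meson rtrancl_trans symD)
    then show "(x, y) \<in> reachable ?H"
      using that by (simp add: reachable_def verts r_def)
  qed
  have "card (blocks ?G c) = card (f ` ?V)"
    unfolding blocks_def connected_components_def verts
    by (rule card_quotient_eq_card_image[OF _ reach]) (auto simp: reachable_def verts)
  \<comment> \<open>Every start \<open>i\<close> of color \<open>a\<close> is attained, since
    \<open>first_layer\<close> fixes it and \<open>a\<close> occurs there.\<close>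
  also have "f ` ?V = (SIGMA a:{..<k}. {i. i < n \<and> block_start m c a i})"
  proof (intro equalityI subsetI)
    fix z assume "z \<in> f ` ?V"
    then obtain v i where "v < m" "i < n" "z = f (v, i)"
      by auto
    then show "z \<in> (SIGMA a:{..<k}. {i. i < n \<and> block_start m c a i})"
      using assms block_start_first_layer[of v m c i] first_layer_le[of m c "c (v, i)" i]
      by (auto simp: f_def)
  next
    fix z assume "z \<in> (SIGMA a:{..<k}. {i. i < n \<and> block_start m c a i})"
    then obtain a i where z: "z = (a, i)" "i < n" "block_start m c a i"
      by auto
    then obtain v where "v < m" "c (v, i) = a"
      using block_start_color by blast
    with z have "z = f (v, i)" "(v, i) \<in> ?V"
      by (auto simp: f_def first_layer_block_start)
    then show "z \<in> f ` ?V"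
      by blast
  qed
  also have "card \<dots> = (\<Sum>a<k. card {i. i < n \<and> block_start m c a i})"
    by (rule card_SigmaI) auto
  also have "\<dots> = (\<Sum>a<k. \<Sum>i<n. of_bool (block_start m c a i))"
    by (simp add: of_bool_def sum.If_cases Int_def)
  finally show ?thesis .
qed

section \<open>Probability that a block of a given color starts in a given layer\<close>

lemma prob_block_start:
  assumes "a < k" "i < n"
  shows "measure_pmf.prob (random_coloring k (cartesian_product (complete_graph m) (path_graph n)))
           {c. block_start m c a i} =
         (if i = 0 then 1 else (1 - 1 / real k ^ 2) ^ m) - (1 - 1 / real k) ^ m"
proof -
  let ?V = "{..<m} \<times> {..<n}"
  define M where "M = random_coloring k (cartesian_product (complete_graph m) (path_graph n))"
  have M: "M = Pi_pmf ?V 0 (\<lambda>_. pmf_of_set {..<k})"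
    by (simp add: M_def random_coloring_def cartesian_product_def complete_graph_def path_graph_def)
  have pmf_a: "pmf (pmf_of_set {..<k}) a = 1 / real k"
    using assms by (subst pmf_of_set) auto
  define N where "N = {c. \<forall>v\<in>{..<m}. \<exists>x\<in>{(v, i)}. c x \<noteq> a}"
  have N: "measure_pmf.prob M N = (1 - 1 / real k) ^ m"
    unfolding M N_def using assms
    by (subst prob_Pi_pmf_no_constant_cell) (auto simp: disjoint_family_on_def pmf_a)
  show ?thesis
  proof (cases i)
    case 0
    have "{c. block_start m c a i} = UNIV - N"
      by (auto simp: 0 N_def)
    then show ?thesis
      using measure_pmf.prob_compl[of N M] by (simp add: N 0 flip: M_def)
  next
    case (Suc j)
    define U where "U = {c. \<forall>v\<in>{..<m}. \<exists>x\<in>{(v, j), (v, i)}. c x \<noteq> a}"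
    have U: "measure_pmf.prob M U = (1 - 1 / real k ^ 2) ^ m"
      unfolding M U_def using assms
      by (subst prob_Pi_pmf_no_constant_cell)
         (auto simp: disjoint_family_on_def pmf_a Suc power2_eq_square)
    \<comment> \<open>A color absent from layer \<open>i\<close> cannot be linked into it, so
      \<open>N\<close> lies in \<open>U\<close> and the probabilities subtract.\<close>
    have "{c. block_start m c a i} = U - N" "N \<subseteq> U"
      by (auto simp: Suc N_def U_def linked_def)
    then show ?thesis
      using measure_pmf.finite_measure_Diff[of U M N] by (simp add: N U Suc flip: M_def)
  qed
qed

theorem expected_blocks_complete_path_product:
  assumes "k \<ge> 1" "n \<ge> 1"
  shows "expected_blocks k (cartesian_product (complete_graph m) (path_graph n)) =
           real k * (1 - (1 - 1 / real k) ^ m +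
             (real n - 1) * ((1 - 1 / real k ^ 2) ^ m - (1 - 1 / real k) ^ m))"
proof -
  let ?G = "cartesian_product (complete_graph m) (path_graph n)"
  define M where "M = random_coloring k ?G"
  have M: "M = Pi_pmf ({..<m} \<times> {..<n}) 0 (\<lambda>_. pmf_of_set {..<k})"
    by (simp add: M_def random_coloring_def cartesian_product_def complete_graph_def path_graph_def)
  \<comment> \<open>Off the vertex set the value is the default 0, which is below \<open>k\<close>
    because \<open>k\<close> is positive.\<close>
  have supp: "c x < k" if "c \<in> set_pmf M" for c x
  proof (cases "x \<in> {..<m} \<times> {..<n}")
    case True
    then have "c x \<in> set_pmf (pmf_of_set {..<k})"
      using that by (auto simp: M set_Pi_pmf PiE_dflt_def)
    then show ?thesis
      using assms by (subst (asm) set_pmf_of_set) (auto simp: lessThan_empty_iff)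
  next
    case False
    then show ?thesis
      using that assms by (cases x) (auto simp: M set_Pi_pmf PiE_dflt_def)
  qed
  have int: "integrable M (indicat_real A)" for A
    by (rule integrable_real_indicator) (auto simp: measure_pmf.emeasure_eq_measure)
  have "real (card (blocks ?G c)) = (\<Sum>a<k. \<Sum>i<n. indicator {c. block_start m c a i} c)"
    if "c \<in> set_pmf M" for c
    using card_blocks_complete_path_product[of c k m n] supp[OF that]
    by (auto simp: indicator_def of_bool_def intro!: sum.cong)
  then have "expected_blocks k ?G = measure_pmf.expectation M
      (\<lambda>c. \<Sum>a<k. \<Sum>i<n. indicator {c. block_start m c a i} c)"
    unfolding expected_blocks_def M_def[symmetric]
    by (intro integral_cong_AE AE_pmfI) simp_all
  also have "\<dots> = (\<Sum>a<k. \<Sum>i<n. measure_pmf.prob M {c. block_start m c a i})"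
    by (subst Bochner_Integration.integral_sum | intro Bochner_Integration.integrable_sum sum.cong int | simp)+
  also have "\<dots> = (\<Sum>a<k. \<Sum>i<n.
      (if i = 0 then 1 else (1 - 1 / real k ^ 2) ^ m) - (1 - 1 / real k) ^ m)"
    by (intro sum.cong) (auto simp: M_def prob_block_start)
  \<comment> \<open>The summand does not depend on the color. Writing \<open>n\<close> as a
    successor splits off layer 0, the only one without a predecessor.\<close>
  also have "\<dots> = real k * (\<Sum>i<Suc (n - 1).
      (if i = 0 then 1 else (1 - 1 / real k ^ 2) ^ m) - (1 - 1 / real k) ^ m)"
    using assms by simp
  also have "\<dots> = real k * (1 - (1 - 1 / real k) ^ m +
      (real n - 1) * ((1 - 1 / real k ^ 2) ^ m - (1 - 1 / real k) ^ m))"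
    using assms by (subst sum.lessThan_Suc_shift) (simp add: of_nat_diff)
  finally show ?thesis .
qed

theorem corollary6p7:
  fixes n :: nat
  assumes "n \<ge> 1"
  shows "expected_blocks 2 (cartesian_product (complete_graph 4) (path_graph n)) =
           2 powi (4 * int n - 7) * (175 + 65 * real n) / 2 ^ (4 * n)"
proof -
  \<comment> \<open>The exponent is negative for \<open>n = 1\<close>, so the factor 1/128 is
    separated before passing to natural powers.\<close>
  have "(2::real) powi (4 * int n - 7) = 2 powi int (4 * n) / 2 powi 7"
    by (subst power_int_diff) auto
  then have "(2::real) powi (4 * int n - 7) = 2 ^ (4 * n) / 128"
    by (simp only: power_int_of_nat) simp
  then have "2 powi (4 * int n - 7) * (175 + 65 * real n) / 2 ^ (4 * n) = (175 + 65 * real n) / 128"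
    by (simp only:) simp
  \<comment> \<open>With two colors and four positions this is 2 (15/16 + (n - 1) (81/256 -
    16/256)).\<close>
  moreover have "expected_blocks 2 (cartesian_product (complete_graph 4) (path_graph n)) =
      (175 + 65 * real n) / 128"
    using assms by (simp add: expected_blocks_complete_path_product power_numeral_reduce field_simps)
  ultimately show ?thesis
    by (simp only:)
qed

end
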